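(* Let $S\in M_{2n}(\mathbb{C})$ be symplectic with $\lambda_1\in\sigma(S)$ and let $\mu\in\mathbb{C}\setminus\{0\}$ be given. Let $x_1,x_2\in\mathbb{C}^{2n}$ be eigenvectors of $S$ for $\lambda_1$ and $\lambda_1^{-1}$, respectively, such that $X=[\,x_1\;x_2\,]$ satisfies $X^TJX=J_2$, let $R=[r_{ij}]\in M_2(\mathbb{C})$ satisfy $$(\mu+\mu^{-1})-(\lambda_1+\lambda_1^{-1}) = \lambda_1r_{12}-\lambda_1^{-1}r_{21}\quad\text{and}\quad 0=r_{12}-r_{21}+r_{11}r_{22}-r_{12}r_{21},$$ and let $\hat{S}=S+XRX^TJ^TS$. Then for any $\lambda\in\sigma(\hat{S})$ with $\lambda\notin\{\lambda_1,\lambda_1^{-1},\mu,\mu^{-1}\}$, the Segre characteristics of $\lambda$ as an eigenvalue of $S$ and of $\hat{S}$ are identical, and the Jordan chains of $S$ for $\lambda$ and the Jordan chains of $\hat{S}$ for $\lambda$ are identical.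
   Context: $M_n(\mathbb{C})$ is the set of complex $n\times n$ matrices, $\sigma(S)$ is the spectrum, $^T$ is the transpose without conjugation. $J=J_{2n} = \begin{bmatrix} 0 & I_n \\ -I_n & 0\end{bmatrix}$ and $J_2=\begin{bmatrix}0&1\\-1&0\end{bmatrix}$; $S\in M_{2n}(\mathbb{C})$ is symplectic if $S^TJS=J$. The Segre characteristic of an eigenvalue $\lambda$ of a matrix is the sequence of sizes of its Jordan blocks with eigenvalue $\lambda$ in non-increasing order. A Jordan chain of $S$ for $\lambda$ is a sequence $y_1,\ldots,y_p\in\mathbb{C}^{2n}$ ($p\ge1$, $y_1\neq0$) with $(S-\lambda I_{2n})y_1=0$ and $(S-\lambda I_{2n})y_{k+1}=y_k$ for $k=1,\ldots,p-1$. *)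

theory Defs
  imports
    "Jordan_Normal_Form.Jordan_Normal_Form_Uniqueness"
    "Jordan_Normal_Form.Spectral_Radius"
begin

definition J_mat :: "nat \<Rightarrow> complex mat" where
  "J_mat n = four_block_mat (0\<^sub>m n n) (1\<^sub>m n) (- 1\<^sub>m n) (0\<^sub>m n n)"

lemma J_mat_1: "J_mat 1 = mat_of_rows_list 2 [[0, 1], [-1, 0]]"
  by (rule eq_matI)
    (auto simp: J_mat_def mat_of_rows_list_def four_block_mat_def Let_def less_2_cases_iff)

definition symplectic :: "nat \<Rightarrow> complex mat \<Rightarrow> bool" where
  "symplectic n S \<longleftrightarrow>
     S \<in> carrier_mat (2 * n) (2 * n) \<and> transpose_mat S * J_mat n * S = J_mat n"

definition segre_characteristic :: "complex mat \<Rightarrow> complex \<Rightarrow> nat list" where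
  "segre_characteristic A ev =
     (THE ks. \<exists>n_as. jordan_nf A n_as \<and> ks = rev (sort (map fst (filter (\<lambda>(k, a). a = ev) n_as))))"

text \<open>The description is meaningful: every square complex matrix has a Jordan normal form, and
  the sorted list of block sizes does not depend on the one chosen.\<close>

lemma segre_characteristic_eq:
  assumes "jordan_nf A n_as"
  shows "segre_characteristic A ev = rev (sort (map fst (filter (\<lambda>(k, a). a = ev) n_as)))"
proof -
  have count_sizes: "count (mset (map fst (filter (\<lambda>(k, a). a = ev) xs))) k
      = (if k = 0 then 0 else compute_nr_of_jordan_blocks A ev k)"
    if jnf: "jordan_nf A xs" for xs k
  proof -
    have cnt: "count (mset (map fst (filter (\<lambda>(k, a). a = ev) ys))) k
      = length (filter ((=) (k, ev)) ys)" for ys :: "(nat \<times> complex) list"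
      by (induction ys) auto
    show ?thesis
    proof (cases "k = 0")
      case True
      with jnf have "(k, ev) \<notin> set xs"
        by (force simp: jordan_nf_def)
      then have "filter ((=) (k, ev)) xs = []"
        by (auto simp: filter_empty_conv)
      with True show ?thesis unfolding cnt by simp
    next
      case False
      then show ?thesis
        unfolding cnt compute_nr_of_jordan_blocks[OF jnf False] by simp
    qed
  qed
  have unique: "sort (map fst (filter (\<lambda>(k, a). a = ev) xs))
      = sort (map fst (filter (\<lambda>(k, a). a = ev) n_as))"
    if "jordan_nf A xs" for xs
  proof -
    have "mset (map fst (filter (\<lambda>(k, a). a = ev) xs))
        = mset (map fst (filter (\<lambda>(k, a). a = ev) n_as))"
      by (rule multiset_eqI) (simp only: count_sizes[OF that] count_sizes[OF assms])
    then show ?thesis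
      by (rule properties_for_sort[OF trans[OF mset_sort sym] sorted_sort])
  qed
  show ?thesis
    unfolding segre_characteristic_def
  proof (rule the_equality)
    fix ks
    assume "\<exists>xs. jordan_nf A xs \<and> ks = rev (sort (map fst (filter (\<lambda>(k, a). a = ev) xs)))"
    then show "ks = rev (sort (map fst (filter (\<lambda>(k, a). a = ev) n_as)))"
      using unique by metis
  qed (use assms in blast)
qed

lemma complex_jordan_nf_exists:
  fixes A :: "complex mat"
  assumes "A \<in> carrier_mat n n"
  shows "\<exists>n_as. jordan_nf A n_as"
  using char_poly_factorized[OF assms] jordan_nf_exists[OF assms] by blast

definition jordan_chain :: "complex mat \<Rightarrow> complex \<Rightarrow> complex vec list \<Rightarrow> bool" where
  "jordan_chain A ev ys \<longleftrightarrow>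
     ys \<noteq> [] \<and> set ys \<subseteq> carrier_vec (dim_row A) \<and> ys ! 0 \<noteq> 0\<^sub>v (dim_row A) \<and>
     (A - ev \<cdot>\<^sub>m 1\<^sub>m (dim_row A)) *\<^sub>v (ys ! 0) = 0\<^sub>v (dim_row A) \<and>
     (\<forall>k. Suc k < length ys \<longrightarrow>
       (A - ev \<cdot>\<^sub>m 1\<^sub>m (dim_row A)) *\<^sub>v (ys ! Suc k) = ys ! k)"

end

theory Submission
  imports Defs
begin

text \<open>Put \<open>P = X\<^sup>T J\<^sup>T\<close>, \<open>D = diag (\<lambda>\<^sub>1, \<lambda>\<^sub>1\<^sup>-\<^sup>1)\<close> and
  \<open>L = D\<^sup>-\<^sup>1\<close>. Because \<open>S\<close> is symplectic, its right eigenvectors \<open>X\<close> give left eigenvectors: transposing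
  \<open>S X = X D\<close> and using \<open>S\<^sup>T J\<^sup>T S = J\<^sup>T\<close> gives \<open>D P S = P\<close>, that is, \<open>P S = L P\<close>. The perturbation
  is \<open>X R P S = X R L P\<close>, so it vanishes on the kernel of \<open>P\<close>; and since \<open>P X = J\<^sub>2\<^sup>T\<close>, the matrix
  \<open>P\<close> intertwines the perturbed matrix as well, now with \<open>M = L + J\<^sub>2\<^sup>T R L\<close>. The first condition on
  \<open>R\<close> says that \<open>M\<close> has trace \<open>\<mu> + \<mu>\<^sup>-\<^sup>1\<close>, the second that \<open>M\<close> has determinant 1, so the
  eigenvalues of \<open>M\<close> are \<open>\<mu>\<close> and \<open>\<mu>\<^sup>-\<^sup>1\<close>, while those of \<open>L\<close> are \<open>\<lambda>\<^sub>1\<close> and its inverse.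

  For \<open>\<lambda>\<close> outside these four numbers, \<open>P (S - \<lambda>) = (L - \<lambda>) P\<close> with \<open>L - \<lambda>\<close> injective, so \<open>P\<close>
  annihilates every \<open>v\<close> for which it annihilates \<open>(S - \<lambda>) v\<close>; climbing up from 0, it annihilates
  each vector of a Jordan chain and each generalized eigenvector. On all these
  vectors the two matrices agree, so the chains of \<open>S\<close> are chains of the perturbed matrix. The same
  argument with \<open>M\<close> in place of \<open>L\<close> gives the converse. In particular
  the kernels of all powers of \<open>S - \<lambda>\<close> are unchanged, and their dimensions determine the Segre
  characteristic. The general argument is \<open>same_jordan_structure\<close>; the spectra of \<open>L\<close> and \<open>M\<close>
  both come from \<open>unimodular_2x2_not_eigenvalue\<close>.\<close>

section \<open>Matrices that agree on the kernel of a common intertwiner\<close>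

lemma intertwining_char_matrix:
  fixes A L P :: "'a :: field mat"
  assumes A: "A \<in> carrier_mat n n" and P: "P \<in> carrier_mat k n" and L: "L \<in> carrier_mat k k"
    and PA: "P * A = L * P" and v: "v \<in> carrier_vec n"
  shows "P *\<^sub>v (char_matrix A e *\<^sub>v v) = char_matrix L e *\<^sub>v (P *\<^sub>v v)"
proof -
  have "P * char_matrix A e = P * A + (- e) \<cdot>\<^sub>m P"
    using A P by (simp add: char_matrix_def mult_add_distrib_mat[of _ k n _ n]
        mult_smult_distrib[of _ k n _ n])
  moreover have "char_matrix L e * P = L * P + (- e) \<cdot>\<^sub>m P"
    using L P by (simp add: char_matrix_def add_mult_distrib_mat[of _ k k _ _ n]
        mult_smult_assoc_mat[of _ k k _ n])
  ultimately have "P * char_matrix A e = char_matrix L e * P"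
    using PA by simp
  then have "(P * char_matrix A e) *\<^sub>v v = (char_matrix L e * P) *\<^sub>v v"
    by simp
  then show ?thesis
    using assoc_mult_mat_vec[OF P char_matrix_closed[OF A] v]
      assoc_mult_mat_vec[OF char_matrix_closed[OF L] P v] by simp
qed

lemma char_matrix_mult_vec:
  fixes A :: "'a :: field mat"
  assumes "A \<in> carrier_mat n n" "v \<in> carrier_vec n"
  shows "char_matrix A e *\<^sub>v v = A *\<^sub>v v + ((- e) \<cdot>\<^sub>m 1\<^sub>m n) *\<^sub>v v"
  using assms by (auto simp: char_matrix_def intro: add_mult_distrib_mat_vec)

text \<open>The intertwining relation carries over to \<open>A - e\<close> and \<open>L - e\<close>, and the latter is injective
  when \<open>e\<close> is not an eigenvalue of \<open>L\<close>. This is the step that climbs a Jordan chain from one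
  vector to the next.\<close>

lemma intertwiner_kills_preimage:
  fixes A L P :: "'a :: field mat"
  assumes A: "A \<in> carrier_mat n n" and P: "P \<in> carrier_mat k n" and L: "L \<in> carrier_mat k k"
    and PA: "P * A = L * P" and ev: "\<not> eigenvalue L e" and v: "v \<in> carrier_vec n"
    and zero: "P *\<^sub>v (char_matrix A e *\<^sub>v v) = 0\<^sub>v k"
  shows "P *\<^sub>v v = 0\<^sub>v k"
proof -
  have "char_matrix L e *\<^sub>v (P *\<^sub>v v) = 0\<^sub>v k"
    using zero intertwining_char_matrix[OF A P L PA v] by simp
  moreover have "P *\<^sub>v v \<in> carrier_vec k"
    using P v by simp
  ultimately show ?thesis
    using ev eigenvector_char_matrix[OF L] unfolding eigenvalue_def by blast
qed

text \<open>Peeling off the rightmost factor of \<open>(A - e)\<^sup>j\<close>, the vector \<open>(A - e) v\<close> is already known to lie in the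
  kernel of \<open>P\<close>, hence so does \<open>v\<close>, and there \<open>A - e\<close> may be replaced by \<open>B - e\<close>. That \<open>P v = 0\<close> is
  part of the conclusion because the induction needs it.\<close>

lemma generalized_eigenvector_transfer:
  fixes A B L P :: "'a :: field mat"
  assumes A: "A \<in> carrier_mat n n" and B: "B \<in> carrier_mat n n"
    and P: "P \<in> carrier_mat k n" and L: "L \<in> carrier_mat k k"
    and PA: "P * A = L * P" and ev: "\<not> eigenvalue L e"
    and agree: "\<And>v. v \<in> carrier_vec n \<Longrightarrow> P *\<^sub>v v = 0\<^sub>v k \<Longrightarrow> A *\<^sub>v v = B *\<^sub>v v"
    and v: "v \<in> carrier_vec n" and zero: "(char_matrix A e ^\<^sub>m j) *\<^sub>v v = 0\<^sub>v n"
  shows "P *\<^sub>v v = 0\<^sub>v k \<and> (char_matrix B e ^\<^sub>m j) *\<^sub>v v = 0\<^sub>v n"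
  using v zero
proof (induction j arbitrary: v)
  case 0
  then have "v = 0\<^sub>v n" using carrier_matD(1)[OF char_matrix_closed[OF A]] by simp
  then show ?case using carrier_matD(1)[OF char_matrix_closed[OF B]] P by auto
next
  case (Suc j)
  note cA = char_matrix_closed[OF A, of e] and cB = char_matrix_closed[OF B, of e]
  let ?w = "char_matrix A e *\<^sub>v v"
  have w: "?w \<in> carrier_vec n" using cA Suc.prems by simp
  have "(char_matrix A e ^\<^sub>m j) *\<^sub>v ?w = 0\<^sub>v n"
    using Suc.prems assoc_mult_mat_vec[OF pow_carrier_mat[OF cA] cA Suc.prems(1)] by simp
  then have IH: "P *\<^sub>v ?w = 0\<^sub>v k" "(char_matrix B e ^\<^sub>m j) *\<^sub>v ?w = 0\<^sub>v n"
    using Suc.IH[OF w] by auto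
  have Pv: "P *\<^sub>v v = 0\<^sub>v k"
    using intertwiner_kills_preimage[OF A P L PA ev Suc.prems(1) IH(1)] .
  have "?w = char_matrix B e *\<^sub>v v"
    using agree[OF Suc.prems(1) Pv] char_matrix_mult_vec[OF A Suc.prems(1)]
      char_matrix_mult_vec[OF B Suc.prems(1)] by simp
  then have "(char_matrix B e ^\<^sub>m Suc j) *\<^sub>v v = 0\<^sub>v n"
    using IH(2) assoc_mult_mat_vec[OF pow_carrier_mat[OF cB] cB Suc.prems(1)] by simp
  with Pv show ?case by blast
qed

lemma jordan_chain_char_matrix:
  assumes "A \<in> carrier_mat n n"
  shows "jordan_chain A ev ys \<longleftrightarrow>
     ys \<noteq> [] \<and> set ys \<subseteq> carrier_vec n \<and> ys ! 0 \<noteq> 0\<^sub>v n \<and>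
     char_matrix A ev *\<^sub>v (ys ! 0) = 0\<^sub>v n \<and>
     (\<forall>i. Suc i < length ys \<longrightarrow> char_matrix A ev *\<^sub>v (ys ! Suc i) = ys ! i)"
proof -
  have "A - ev \<cdot>\<^sub>m 1\<^sub>m (dim_row A) = char_matrix A ev"
    using assms by (intro eq_matI) (auto simp: char_matrix_def)
  then show ?thesis
    using assms unfolding jordan_chain_def by auto
qed

text \<open>A chain starts in the kernel of \<open>A - e\<close>, hence in the kernel of \<open>P\<close>, and each of its vectors is
  a preimage of the one before, so the whole chain stays in the kernel of \<open>P\<close>.\<close>

lemma jordan_chain_transfer:
  fixes A B L P :: "complex mat"
  assumes A: "A \<in> carrier_mat n n" and B: "B \<in> carrier_mat n n"
    and P: "P \<in> carrier_mat k n" and L: "L \<in> carrier_mat k k"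
    and PA: "P * A = L * P" and ev: "\<not> eigenvalue L e"
    and agree: "\<And>v. v \<in> carrier_vec n \<Longrightarrow> P *\<^sub>v v = 0\<^sub>v k \<Longrightarrow> A *\<^sub>v v = B *\<^sub>v v"
    and chain: "jordan_chain A e ys"
  shows "jordan_chain B e ys"
proof -
  note ch = chain[unfolded jordan_chain_char_matrix[OF A]]
  have ys: "ys ! i \<in> carrier_vec n" if "i < length ys" for i
    using ch that nth_mem by blast
  have P0: "P *\<^sub>v 0\<^sub>v n = 0\<^sub>v k" using P by auto
  have kill: "P *\<^sub>v (ys ! i) = 0\<^sub>v k" if "i < length ys" for i
    using that
  proof (induction i)
    case 0
    then show ?case
      using intertwiner_kills_preimage[OF A P L PA ev ys] ch P0 by simp
  next
    case (Suc i)
    then have "P *\<^sub>v (char_matrix A e *\<^sub>v (ys ! Suc i)) = 0\<^sub>v k"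
      using ch by simp
    then show ?case
      using intertwiner_kills_preimage[OF A P L PA ev ys] Suc.prems by blast
  qed
  have same: "char_matrix A e *\<^sub>v (ys ! i) = char_matrix B e *\<^sub>v (ys ! i)" if "i < length ys" for i
    using agree[OF ys[OF that] kill[OF that]] char_matrix_mult_vec[OF A ys[OF that]]
      char_matrix_mult_vec[OF B ys[OF that]] by simp
  show ?thesis
    unfolding jordan_chain_char_matrix[OF B] using ch same by auto
qed

section \<open>Segre characteristics and generalized eigenspaces\<close>

text \<open>The number of blocks of size \<open>k\<close> is a second difference of the dimensions of the generalized
  eigenspaces, so equal eigenspaces force equal multisets of block sizes.\<close>

lemma segre_characteristic_eqI:
  assumes A: "A \<in> carrier_mat n n" and B: "B \<in> carrier_mat n n"
    and ker: "\<And>j. mat_kernel (char_matrix A e ^\<^sub>m j) = mat_kernel (char_matrix B e ^\<^sub>m j)"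
  shows "segre_characteristic A e = segre_characteristic B e"
proof -
  obtain as bs where as: "jordan_nf A as" and bs: "jordan_nf B bs"
    using complex_jordan_nf_exists[OF A] complex_jordan_nf_exists[OF B] by blast
  have "dim_col (char_matrix A e ^\<^sub>m j) = n" "dim_col (char_matrix B e ^\<^sub>m j) = n" for j
    using A B pow_carrier_mat[OF char_matrix_closed] by (metis carrier_matD(2))+
  then have "dim_gen_eigenspace A e j = dim_gen_eigenspace B e j" for j
    unfolding dim_gen_eigenspace_def kernel_dim_def using ker by simp
  then have nr: "compute_nr_of_jordan_blocks A e k = compute_nr_of_jordan_blocks B e k" for k
    unfolding compute_nr_of_jordan_blocks_def by simp
  have cnt: "count (mset (map fst (filter (\<lambda>(k, a). a = e) ys))) k
      = length (filter ((=) (k, e)) ys)" for ys :: "(nat \<times> complex) list" and k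
    by (induction ys) auto
  have "length (filter ((=) (k, e)) as) = length (filter ((=) (k, e)) bs)" for k
  proof (cases "k = 0")
    case True
    \<comment> \<open>Block counting says nothing about size 0, but a Jordan normal form has no such blocks.\<close>
    have "(0, e) \<notin> set as" "(0, e) \<notin> set bs"
      using as bs by (force simp: jordan_nf_def)+
    then have "filter ((=) (k, e)) as = []" "filter ((=) (k, e)) bs = []"
      using True by (auto simp: filter_empty_conv)
    then show ?thesis by simp
  next
    case False
    then show ?thesis
      using compute_nr_of_jordan_blocks[OF as False] compute_nr_of_jordan_blocks[OF bs False] nr
      by metis
  qed
  then have "mset (map fst (filter (\<lambda>(k, a). a = e) as))
      = mset (map fst (filter (\<lambda>(k, a). a = e) bs))"
    by (intro multiset_eqI) (simp only: cnt)
  then have "sort (map fst (filter (\<lambda>(k, a). a = e) as))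
      = sort (map fst (filter (\<lambda>(k, a). a = e) bs))"
    by (intro properties_for_sort) auto
  then show ?thesis
    using segre_characteristic_eq[OF as] segre_characteristic_eq[OF bs] by simp
qed

text \<open>The transfer lemmas use only the spectrum of the matrix on the source side, so the hypotheses
  on \<open>L\<close> give one inclusion and those on \<open>M\<close> the other.\<close>

lemma same_jordan_structure:
  fixes A B L M P :: "complex mat"
  assumes A: "A \<in> carrier_mat n n" and B: "B \<in> carrier_mat n n"
    and P: "P \<in> carrier_mat k n" and L: "L \<in> carrier_mat k k" and M: "M \<in> carrier_mat k k"
    and PA: "P * A = L * P" and PB: "P * B = M * P"
    and evL: "\<not> eigenvalue L e" and evM: "\<not> eigenvalue M e"
    and agree: "\<And>v. v \<in> carrier_vec n \<Longrightarrow> P *\<^sub>v v = 0\<^sub>v k \<Longrightarrow> A *\<^sub>v v = B *\<^sub>v v"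
  shows "segre_characteristic A e = segre_characteristic B e"
    and "jordan_chain A e ys \<longleftrightarrow> jordan_chain B e ys"
proof -
  note agree' = agree[symmetric]
  show "jordan_chain A e ys \<longleftrightarrow> jordan_chain B e ys"
    using jordan_chain_transfer[OF A B P L PA evL agree]
      jordan_chain_transfer[OF B A P M PB evM agree'] by blast
  show "segre_characteristic A e = segre_characteristic B e"
  proof (rule segre_characteristic_eqI[OF A B])
    fix j
    have "char_matrix A e ^\<^sub>m j \<in> carrier_mat n n" "char_matrix B e ^\<^sub>m j \<in> carrier_mat n n"
      using A B by (simp_all add: pow_carrier_mat)
    then show "mat_kernel (char_matrix A e ^\<^sub>m j) = mat_kernel (char_matrix B e ^\<^sub>m j)"
      using generalized_eigenvector_transfer[OF A B P L PA evL agree]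
        generalized_eigenvector_transfer[OF B A P M PB evM agree']
      by (auto simp: mat_kernel)
  qed
qed

section \<open>The two by two compressions\<close>

text \<open>Trace \<open>a + a\<^sup>-\<^sup>1\<close> and determinant 1 make the characteristic polynomial
  \<open>(t - a) (t - a\<^sup>-\<^sup>1)\<close>.\<close>

lemma unimodular_2x2_not_eigenvalue:
  fixes M :: "'a :: field mat"
  assumes M: "M \<in> carrier_mat 2 2" and a: "a \<noteq> 0"
    and trace: "M $$ (0, 0) + M $$ (1, 1) = a + inverse a"
    and det: "M $$ (0, 0) * M $$ (1, 1) - M $$ (0, 1) * M $$ (1, 0) = 1"
    and e: "e \<noteq> a" "e \<noteq> inverse a"
  shows "\<not> eigenvalue M e"
proof
  assume "eigenvalue M e"
  then obtain v where v: "v \<in> carrier_vec 2" and nz: "v \<noteq> 0\<^sub>v 2" and Mv: "M *\<^sub>v v = e \<cdot>\<^sub>v v"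
    using M unfolding eigenvalue_def eigenvector_def by auto
  have row: "M $$ (i, 0) * v $ 0 + M $$ (i, 1) * v $ 1 = e * v $ i" if i: "i < 2" for i
  proof -
    have "(M *\<^sub>v v) $ i = (e \<cdot>\<^sub>v v) $ i" using Mv by simp
    then show ?thesis
      using i M v by (simp add: scalar_prod_def numeral_2_eq_2)
  qed
  define p where "p = (e - a) * (e - inverse a)"
  \<comment> \<open>Cramer's rule: \<open>p\<close> is the determinant of \<open>M - e\<close>.\<close>
  have p: "p = (M $$ (0, 0) - e) * (M $$ (1, 1) - e) - M $$ (0, 1) * M $$ (1, 0)"
  proof -
    have "p = e * e - e * (a + inverse a) + 1"
      using a unfolding p_def by (simp add: algebra_simps)
    also have "\<dots> = e * e - e * (M $$ (0, 0) + M $$ (1, 1))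
        + (M $$ (0, 0) * M $$ (1, 1) - M $$ (0, 1) * M $$ (1, 0))"
      using trace det by simp
    finally show ?thesis by (simp add: algebra_simps)
  qed
  have r0: "(M $$ (0, 0) - e) * v $ 0 + M $$ (0, 1) * v $ 1 = 0"
    and r1: "M $$ (1, 0) * v $ 0 + (M $$ (1, 1) - e) * v $ 1 = 0"
    using row[of 0] row[of 1] by (simp_all add: algebra_simps)
  have "p * v $ 0 = (M $$ (1, 1) - e) * ((M $$ (0, 0) - e) * v $ 0 + M $$ (0, 1) * v $ 1)
      - M $$ (0, 1) * (M $$ (1, 0) * v $ 0 + (M $$ (1, 1) - e) * v $ 1)"
    unfolding p by (simp add: algebra_simps)
  moreover have "p * v $ 1 = (M $$ (0, 0) - e) * (M $$ (1, 0) * v $ 0 + (M $$ (1, 1) - e) * v $ 1)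
      - M $$ (1, 0) * ((M $$ (0, 0) - e) * v $ 0 + M $$ (0, 1) * v $ 1)"
    unfolding p by (simp add: algebra_simps)
  moreover have "p \<noteq> 0" using e unfolding p_def by simp
  ultimately have "v $ 0 = 0" "v $ 1 = 0" unfolding r0 r1 by simp_all
  then have "v = 0\<^sub>v 2" using v by (intro eq_vecI) (auto simp: less_2_cases_iff)
  with nz show False by simp
qed

definition diag2 :: "'a :: zero \<Rightarrow> 'a \<Rightarrow> 'a mat" where
  "diag2 a b = mat 2 2 (\<lambda>(i, j). if i \<noteq> j then 0 else if i = 0 then a else b)"

lemma diag2_carrier [simp]: "diag2 a b \<in> carrier_mat 2 2"
  by (simp add: diag2_def)

lemma diag2_index [simp]:
  "diag2 a b $$ (0, 0) = a" "diag2 a b $$ (0, Suc 0) = 0"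
  "diag2 a b $$ (Suc 0, 0) = 0" "diag2 a b $$ (Suc 0, Suc 0) = b"
  by (simp_all add: diag2_def)

lemma transpose_diag2: "transpose_mat (diag2 a b) = diag2 a b"
  by (rule eq_matI) (auto simp: diag2_def)

lemma mult_mat_2_index:
  fixes A B :: "'a :: semiring_0 mat"
  assumes "A \<in> carrier_mat m 2" "B \<in> carrier_mat 2 k" "i < m" "j < k"
  shows "(A * B) $$ (i, j) = A $$ (i, 0) * B $$ (0, j) + A $$ (i, 1) * B $$ (1, j)"
  using assms by (simp add: scalar_prod_def numeral_2_eq_2)

lemma diag2_mult_inverse:
  fixes a b :: "'a :: field"
  assumes "a \<noteq> 0" "b \<noteq> 0"
  shows "diag2 a b * diag2 (inverse a) (inverse b) = 1\<^sub>m 2"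
proof (rule eq_matI)
  fix i j assume "i < dim_row (1\<^sub>m 2 :: 'a mat)" "j < dim_col (1\<^sub>m 2 :: 'a mat)"
  then have ij: "i < 2" "j < 2" by auto
  show "(diag2 a b * diag2 (inverse a) (inverse b)) $$ (i, j) = 1\<^sub>m 2 $$ (i, j)"
    using mult_mat_2_index[OF diag2_carrier diag2_carrier ij, of a b "inverse a" "inverse b"]
      ij assms by (auto simp: less_2_cases_iff)
qed (use carrier_matD[OF diag2_carrier] in auto)

lemma eigenvectors_diag2:
  fixes S :: "'a :: field mat"
  assumes S: "S \<in> carrier_mat m m" and x1: "eigenvector S x1 a" and x2: "eigenvector S x2 b"
  shows "S * mat_of_cols m [x1, x2] = mat_of_cols m [x1, x2] * diag2 a b"
proof -
  let ?X = "mat_of_cols m [x1, x2]"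
  have X: "?X \<in> carrier_mat m 2"
    using mat_of_cols_carrier(1)[of m "[x1, x2]"] by (simp add: numeral_2_eq_2)
  have x: "x1 \<in> carrier_vec m" "x2 \<in> carrier_vec m"
    and ev: "S *\<^sub>v x1 = a \<cdot>\<^sub>v x1" "S *\<^sub>v x2 = b \<cdot>\<^sub>v x2"
    using S x1 x2 unfolding eigenvector_def by auto
  show ?thesis
  proof (rule eq_matI)
    fix i j assume "i < dim_row (?X * diag2 a b)" "j < dim_col (?X * diag2 a b)"
    then have i: "i < m" and j: "j < 2"
      using carrier_matD[OF X] carrier_matD[OF diag2_carrier[of a b]] by auto
    have "(S * ?X) $$ (i, j) = (S *\<^sub>v ([x1, x2] ! j)) $ i"
      using S X x i j by (auto simp: less_2_cases_iff)
    also have "\<dots> = (?X * diag2 a b) $$ (i, j)"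
      unfolding mult_mat_2_index[OF X diag2_carrier i j] using ev x i j
      by (auto simp: less_2_cases_iff mat_of_cols_index mult.commute)
    finally show "(S * ?X) $$ (i, j) = (?X * diag2 a b) $$ (i, j)" .
  qed (use carrier_matD[OF S] carrier_matD[OF X] carrier_matD[OF diag2_carrier[of a b]] in auto)
qed

section \<open>The rank-two perturbation of a symplectic matrix\<close>

lemma J_mat_carrier [simp]: "J_mat n \<in> carrier_mat (2 * n) (2 * n)"
  unfolding J_mat_def mult_2 by (rule four_block_carrier_mat) auto

theorem lemma1:
  fixes n :: nat and S X R S_hat :: "complex mat" and x1 x2 :: "complex vec"
    and lam1 mu lam :: complex
  assumes "symplectic n S"
    and "lam1 \<in> spectrum S"
    and "mu \<noteq> 0"
    and "eigenvector S x1 lam1"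
    and "eigenvector S x2 (inverse lam1)"
    and X: "X = mat_of_cols (2 * n) [x1, x2]"
    and "transpose_mat X * J_mat n * X = J_mat 1"
    and "R \<in> carrier_mat 2 2"
    and "(mu + inverse mu) - (lam1 + inverse lam1)
           = lam1 * R $$ (0, 1) - inverse lam1 * R $$ (1, 0)"
    and "0 = R $$ (0, 1) - R $$ (1, 0) + R $$ (0, 0) * R $$ (1, 1) - R $$ (0, 1) * R $$ (1, 0)"
    and S_hat: "S_hat = S + X * R * transpose_mat X * transpose_mat (J_mat n) * S"
    and "lam \<in> spectrum S_hat"
    and "lam \<notin> {lam1, inverse lam1, mu, inverse mu}"
  shows "segre_characteristic S lam = segre_characteristic S_hat lam \<and>
    (\<forall>ys. jordan_chain S lam ys \<longleftrightarrow> jordan_chain S_hat lam ys)"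
proof -
  let ?m = "2 * n"
  let ?J = "transpose_mat (J_mat n)"
  let ?K = "transpose_mat (J_mat 1)"
  let ?D = "diag2 lam1 (inverse lam1)"
  have zero_less_two: "0 < (2::nat)" and one_less_two: "1 < (2::nat)" by simp_all
  define L where "L = diag2 (inverse lam1) lam1"
  define P where "P = transpose_mat X * ?J"
  define M where "M = L + ?K * (R * L)"
  have S: "S \<in> carrier_mat ?m ?m" and SJS: "transpose_mat S * J_mat n * S = J_mat n"
    using assms(1) unfolding symplectic_def by auto
  have Xc: "X \<in> carrier_mat ?m 2"
    using mat_of_cols_carrier(1)[of ?m "[x1, x2]"] X by (simp add: numeral_2_eq_2)
  have Xt: "transpose_mat X \<in> carrier_mat 2 ?m" using Xc by simp
  have St: "transpose_mat S \<in> carrier_mat ?m ?m" using S by simp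
  have J: "?J \<in> carrier_mat ?m ?m" by simp
  have Kc: "?K \<in> carrier_mat 2 2" using J_mat_carrier[of 1] by simp
  have Rc: "R \<in> carrier_mat 2 2" by fact
  have Lc: "L \<in> carrier_mat 2 2" unfolding L_def by simp
  have Pc: "P \<in> carrier_mat 2 ?m" unfolding P_def using Xt J by (rule mult_carrier_mat)
  have Mc: "M \<in> carrier_mat 2 2" unfolding M_def using Kc Rc Lc by simp
  have K: "?K $$ (0, 0) = 0" "?K $$ (0, 1) = - 1" "?K $$ (1, 0) = 1" "?K $$ (1, 1) = 0"
    by (simp_all add: J_mat_1 mat_of_rows_list_def J_mat_1[unfolded One_nat_def])

  \<comment> \<open>Transposing the hypotheses that contain \<open>J\<close> puts them in terms of \<open>J\<^sup>T\<close>, as in \<open>P\<close>.\<close>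
  have PX: "P * X = ?K"
  proof -
    have "transpose_mat (transpose_mat X * J_mat n * X) = transpose_mat X * (?J * X)"
      using Xc Xt by (simp add: transpose_mult[of _ 2 ?m _ 2] transpose_mult[of _ 2 ?m _ ?m]
          mult_carrier_mat[OF Xt J_mat_carrier])
    also have "\<dots> = P * X"
      unfolding P_def using assoc_mult_mat[OF Xt J Xc] by simp
    finally show ?thesis using assms(7) by simp
  qed
  have SJS': "transpose_mat S * (?J * S) = ?J"
  proof -
    have "transpose_mat (transpose_mat S * J_mat n * S) = transpose_mat S * (?J * S)"
      using S St by (simp add: transpose_mult[of _ ?m ?m _ ?m]
          mult_carrier_mat[OF St J_mat_carrier])
    then show ?thesis using SJS by simp
  qed
  have "S * X = X * ?D"
    unfolding X by (rule eigenvectors_diag2[OF S assms(4,5)])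
  then have "transpose_mat (S * X) = transpose_mat (X * ?D)" by simp
  then have XS: "transpose_mat X * transpose_mat S = ?D * transpose_mat X"
    using transpose_mult[OF S Xc] transpose_mult[OF Xc diag2_carrier] transpose_diag2
    by metis
  have JS: "?J * S \<in> carrier_mat ?m ?m" using J S by (rule mult_carrier_mat)
  have DPS: "?D * (P * S) = P"
  proof -
    have "?D * (P * S) = ?D * (transpose_mat X * (?J * S))"
      unfolding P_def using assoc_mult_mat[OF Xt J S] by simp
    also have "\<dots> = (transpose_mat X * transpose_mat S) * (?J * S)"
      unfolding XS using assoc_mult_mat[OF diag2_carrier Xt JS] by simp
    also have "\<dots> = P"
      unfolding P_def using assoc_mult_mat[OF Xt St JS] SJS' by simp
    finally show ?thesis .
  qed
  have PSc: "P * S \<in> carrier_mat 2 ?m" using Pc S by (rule mult_carrier_mat)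
  have lam1: "lam1 \<noteq> 0"
  proof
    \<comment> \<open>Since \<open>inverse 0 = 0\<close>, a zero eigenvalue would make the diagonal matrix vanish.\<close>
    assume "lam1 = 0"
    then have "?D = 0\<^sub>m 2 2"
      by (intro eq_matI) (auto simp: diag2_def)
    then have "P = 0\<^sub>m 2 ?m" using DPS left_mult_zero_mat[OF PSc] by simp
    then have "?K = 0\<^sub>m 2 2" using PX left_mult_zero_mat[OF Xc] by simp
    then show False using K(3) by simp
  qed
  have PS: "P * S = L * P"
  proof -
    have "L * ?D = 1\<^sub>m 2"
      unfolding L_def using diag2_mult_inverse[of "inverse lam1" lam1] lam1 by simp
    moreover have "L * P = L * (?D * (P * S))" using DPS by simp
    ultimately show ?thesis
      using assoc_mult_mat[OF Lc diag2_carrier PSc] left_mult_one_mat[OF PSc] by metis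
  qed
  have RPSc: "R * (P * S) \<in> carrier_mat 2 ?m" using Rc PSc by (rule mult_carrier_mat)
  have S_hat': "S_hat = S + X * (R * (P * S))"
  proof -
    have XR: "X * R \<in> carrier_mat ?m 2" using Xc Rc by (rule mult_carrier_mat)
    have "X * R * transpose_mat X * ?J * S = X * R * P * S"
      unfolding P_def using assoc_mult_mat[OF XR Xt J] by simp
    also have "\<dots> = X * R * (P * S)" using XR Pc S by (rule assoc_mult_mat)
    also have "\<dots> = X * (R * (P * S))" using Xc Rc PSc by (rule assoc_mult_mat)
    finally show ?thesis unfolding S_hat by simp
  qed
  have XRPS: "X * (R * (P * S)) \<in> carrier_mat ?m ?m" using Xc RPSc by (rule mult_carrier_mat)
  have S_hat_c: "S_hat \<in> carrier_mat ?m ?m" unfolding S_hat' using XRPS by simp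
  have PSh: "P * S_hat = M * P"
  proof -
    have RL: "R * L \<in> carrier_mat 2 2" using Rc Lc by (rule mult_carrier_mat)
    have KRL: "?K * (R * L) \<in> carrier_mat 2 2" using Kc RL by (rule mult_carrier_mat)
    have "P * S_hat = P * S + P * (X * (R * (P * S)))"
      unfolding S_hat' using Pc S XRPS by (rule mult_add_distrib_mat)
    also have "P * (X * (R * (P * S))) = ?K * (R * (L * P))"
      using assoc_mult_mat[OF Pc Xc RPSc] PX PS by simp
    also have "\<dots> = ?K * (R * L) * P"
      using assoc_mult_mat[OF Rc Lc Pc] assoc_mult_mat[OF Kc RL Pc] by simp
    also have "P * S + ?K * (R * L) * P = M * P"
      unfolding M_def PS using add_mult_distrib_mat[OF Lc KRL Pc] by simp
    finally show ?thesis .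
  qed
  have agree: "S *\<^sub>v v = S_hat *\<^sub>v v" if v: "v \<in> carrier_vec ?m" and Pv: "P *\<^sub>v v = 0\<^sub>v 2" for v
  proof -
    have "(P * S) *\<^sub>v v = 0\<^sub>v 2"
      unfolding PS using assoc_mult_mat_vec[OF Lc Pc v] Pv Lc by auto
    moreover have "R *\<^sub>v 0\<^sub>v 2 = 0\<^sub>v 2" "X *\<^sub>v 0\<^sub>v 2 = 0\<^sub>v ?m"
      using Rc Xc by auto
    ultimately have "(X * (R * (P * S))) *\<^sub>v v = 0\<^sub>v ?m"
      using assoc_mult_mat_vec[OF Xc RPSc v] assoc_mult_mat_vec[OF Rc PSc v] by simp
    then show ?thesis
      unfolding S_hat' using add_mult_distrib_mat_vec[OF S XRPS v] S v by simp
  qed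
  \<comment> \<open>It remains to exclude \<open>lam\<close> from the spectra of the two compressions.\<close>
  have L_entries: "L $$ (0, 0) = inverse lam1" "L $$ (0, 1) = 0" "L $$ (1, 0) = 0"
      "L $$ (1, 1) = lam1"
    unfolding L_def by simp_all
  have evL: "\<not> eigenvalue L lam"
    using assms(13) lam1 L_entries
    by (intro unimodular_2x2_not_eigenvalue[OF Lc lam1]) auto
  have M_entries: "M $$ (0, 0) = (1 - R $$ (1, 0)) * inverse lam1"
      "M $$ (0, 1) = - R $$ (1, 1) * lam1" "M $$ (1, 0) = R $$ (0, 0) * inverse lam1"
      "M $$ (1, 1) = (1 + R $$ (0, 1)) * lam1"
  proof -
    have "M $$ (i, j) = L $$ (i, j)
        + (?K $$ (i, 0) * (R $$ (0, 0) * L $$ (0, j) + R $$ (0, 1) * L $$ (1, j))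
        + ?K $$ (i, 1) * (R $$ (1, 0) * L $$ (0, j) + R $$ (1, 1) * L $$ (1, j)))"
      if "i < 2" "j < 2" for i j
    proof -
      have RL: "R * L \<in> carrier_mat 2 2" using Rc Lc by (rule mult_carrier_mat)
      have KRL: "?K * (R * L) \<in> carrier_mat 2 2" using Kc RL by (rule mult_carrier_mat)
      have "M $$ (i, j) = L $$ (i, j) + (?K * (R * L)) $$ (i, j)"
        unfolding M_def using carrier_matD[OF KRL] that by (metis index_add_mat(1))
      then show ?thesis
        unfolding mult_mat_2_index[OF Kc RL that]
          mult_mat_2_index[OF Rc Lc zero_less_two that(2)] mult_mat_2_index[OF Rc Lc one_less_two that(2)] .
    qed
    from this[of 0 0] this[of 0 1] this[of 1 0] this[of 1 1]
    show "M $$ (0, 0) = (1 - R $$ (1, 0)) * inverse lam1"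
      "M $$ (0, 1) = - R $$ (1, 1) * lam1" "M $$ (1, 0) = R $$ (0, 0) * inverse lam1"
      "M $$ (1, 1) = (1 + R $$ (0, 1)) * lam1"
      unfolding K L_entries by (simp_all add: algebra_simps)
  qed
  have evM: "\<not> eigenvalue M lam"
  proof (rule unimodular_2x2_not_eigenvalue[OF Mc assms(3)])
    show "M $$ (0, 0) + M $$ (1, 1) = mu + inverse mu"
      unfolding M_entries using assms(9) by (simp add: algebra_simps)
    have "M $$ (0, 0) * M $$ (1, 1) - M $$ (0, 1) * M $$ (1, 0)
        = ((1 - R $$ (1, 0)) * (1 + R $$ (0, 1)) + R $$ (0, 0) * R $$ (1, 1))
          * (inverse lam1 * lam1)"
      unfolding M_entries by (simp add: algebra_simps)
    also have "\<dots> = 1 + (R $$ (0, 1) - R $$ (1, 0) + R $$ (0, 0) * R $$ (1, 1)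
        - R $$ (0, 1) * R $$ (1, 0))"
      using lam1 by (simp add: algebra_simps)
    finally show "M $$ (0, 0) * M $$ (1, 1) - M $$ (0, 1) * M $$ (1, 0) = 1"
      using assms(10) by simp
  qed (use assms(13) in auto)
  show ?thesis
    using same_jordan_structure[OF S S_hat_c Pc Lc Mc PS PSh evL evM agree] by blast
qed

end
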